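(* Let $M,N$ be connected $MC^k$-Fréchet manifolds and let $\varphi:M\to N$ be an $MC^k$-Lipschitz-Fredholm mapping of index zero, $k>1$. If $\varphi$ is locally injective, then $\varphi$ is open.
   Context: Fréchet spaces. Every Fréchet space $F$ is equipped with a fixed translation-invariant metric of the form $\varrho(x,y)=\sup_{n\in\mathbb N}\frac{1}{2^n}\frac{\|x-y\|_{F,n}}{1+\|x-y\|_{F,n}}$, where $\|\cdot\|_{F,n}$ are seminorms generating the topology. For Fréchet spaces $(E,\sigma)$, $(F,\varrho)$, $\mathbb L_{\sigma,\varrho}(E,F)$ is the set of linear maps $L:E\to F$ with $\mathrm{Lip}(L):=\sup_{x\in E\setminus\{0\}}\varrho(L(x),0)/\sigma(x,0)<\infty$, topologized by the metric $(L,H)\mapsto \mathrm{Lip}(L-H)$. $MC^k$-maps. Let $U\subseteq E$ be open and $\varphi:U\to F$ continuous. $\varphi$ is Keller $C^1_c$ if all directional derivatives $D\varphi(x)h=\lim_{t\to0}(\varphi(x+th)-\varphi(x))/t$ exist and $D\varphi:U\to CL(E,F)$ is continuous, where $CL(E,F)$ (continuous linear maps) has the compact-open topology. $\varphi$ is $MC^1$ if it is $C^1_c$, $D\varphi(x)\in\mathbb L_{\sigma,\varrho}(E,F)$ for all $x\in U$, and $\varphi'=D\varphi:U\to\mathbb L_{\sigma,\varrho}(E,F)$ is continuous. $MC^k$ for $k>1$ is defined recursively (for connected open $V\subseteq U$ and $x_0\in V$, the map $\varphi'|_V-\varphi'(x_0)$ into the connected component of $0$ in $\mathbb L_{\sigma,\varrho}(E,F)$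 is required to be $MC^{k-1}$). Manifolds. An $MC^k$-Fréchet manifold is a Hausdorff second countable space modeled on a Fréchet space with an atlas whose transition maps are $MC^k$; $MC^k$-maps between manifolds are defined via charts. Lipschitz-Fredholm. A map in $\mathbb L_{\sigma,\varrho}(E,F)$ is a Lipschitz-Fredholm operator if its kernel is finite-dimensional and its image has finite co-dimension; its index is $\dim\ker-\operatorname{codim}\operatorname{Img}$. An $MC^k$-Lipschitz-Fredholm mapping ($k\ge1$) is an $MC^k$-map $\varphi:M\to N$ all of whose derivatives $D\varphi(x):T_xM\to T_{\varphi(x)}N$ are Lipschitz-Fredholm operators; its index is the index of $D\varphi(x)$, independent of $x$ ($M$ connected). $\varphi$ is locally injective if every point of $M$ has a neighborhood on which $\varphi$ is injective; $\varphi$ is open if it maps open sets to open sets. *)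

theory Defs
  imports "HOL-Analysis.Analysis" "HOL-Library.Function_Algebras"
begin

section \<open>Pointwise real vector space structure on functions\<close>

instantiation "fun" :: (type, real_vector) real_vector
begin

definition scaleR_fun_def: "c *\<^sub>R f = (\<lambda>x. c *\<^sub>R f x)"

instance
  by standard
    (simp_all add: scaleR_fun_def plus_fun_def scaleR_add_right scaleR_add_left)

end

section \<open>Frechet spaces\<close>

definition is_seminorm :: "('a::real_vector \<Rightarrow> real) \<Rightarrow> bool" where
  "is_seminorm p \<longleftrightarrow>
     (\<forall>x. 0 \<le> p x) \<and> (\<forall>x y. p (x + y) \<le> p x + p y) \<and> (\<forall>c x. p (c *\<^sub>R x) = \<bar>c\<bar> * p x)"

definition frechet_dist :: "(nat \<Rightarrow> 'a::real_vector \<Rightarrow> real) \<Rightarrow> 'a \<Rightarrow> 'a \<Rightarrow> real" where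
  "frechet_dist p x y = (SUP n. 1 / 2 ^ n * (p n (x - y) / (1 + p n (x - y))))"

text \<open>The topology generated by the seminorms is the one of the metric, so the Frechet space
  is determined by the sequence of seminorms; its carrier is the whole type.\<close>

definition frechet_space :: "(nat \<Rightarrow> 'a::real_vector \<Rightarrow> real) \<Rightarrow> bool" where
  "frechet_space p \<longleftrightarrow>
     (\<forall>n. is_seminorm (p n)) \<and>
     (\<forall>x. (\<forall>n. p n x = 0) \<longrightarrow> x = 0) \<and>
     Metric_space.mcomplete UNIV (frechet_dist p)"

abbreviation frechet_top :: "(nat \<Rightarrow> 'a::real_vector \<Rightarrow> real) \<Rightarrow> 'a topology" where
  "frechet_top p \<equiv> Metric_space.mtopology UNIV (frechet_dist p)"

section \<open>Lipschitz linear maps\<close>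

text \<open>In what follows the source is a Frechet space with carrier the whole type and metric
  \<open>\<sigma>\<close>; the target is a linear subspace \<open>Y\<close> of a vector space, with a metric \<open>\<rho>\<close> on \<open>Y\<close>.
  Targets other than a whole type arise from the iterated spaces of linear maps below.\<close>

definition Lip :: "('e::real_vector \<Rightarrow> 'e \<Rightarrow> real) \<Rightarrow> ('w::real_vector \<Rightarrow> 'w \<Rightarrow> real)
    \<Rightarrow> ('e \<Rightarrow> 'w) \<Rightarrow> ennreal" where
  "Lip \<sigma> \<rho> L = (SUP x\<in>UNIV - {0}. ennreal (\<rho> (L x) 0 / \<sigma> x 0))"

definition lip_maps :: "('e::real_vector \<Rightarrow> 'e \<Rightarrow> real) \<Rightarrow> 'w set
    \<Rightarrow> ('w::real_vector \<Rightarrow> 'w \<Rightarrow> real) \<Rightarrow> ('e \<Rightarrow> 'w) set" where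
  "lip_maps \<sigma> Y \<rho> = {L. linear L \<and> range L \<subseteq> Y \<and> Lip \<sigma> \<rho> L < \<infinity>}"

definition lip_dist :: "('e::real_vector \<Rightarrow> 'e \<Rightarrow> real) \<Rightarrow> ('w::real_vector \<Rightarrow> 'w \<Rightarrow> real)
    \<Rightarrow> ('e \<Rightarrow> 'w) \<Rightarrow> ('e \<Rightarrow> 'w) \<Rightarrow> real" where
  "lip_dist \<sigma> \<rho> L H = enn2real (Lip \<sigma> \<rho> (L - H))"

definition lip_top :: "('e::real_vector \<Rightarrow> 'e \<Rightarrow> real) \<Rightarrow> 'w set
    \<Rightarrow> ('w::real_vector \<Rightarrow> 'w \<Rightarrow> real) \<Rightarrow> ('e \<Rightarrow> 'w) topology" where
  "lip_top \<sigma> Y \<rho> = Metric_space.mtopology (lip_maps \<sigma> Y \<rho>) (lip_dist \<sigma> \<rho>)"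

section \<open>Keller's \<open>C\<^sup>1\<^sub>c\<close> and \<open>MC\<^sup>1\<close>\<close>

definition compact_open_topology :: "'a topology \<Rightarrow> 'b topology \<Rightarrow> ('a \<Rightarrow> 'b) topology" where
  "compact_open_topology X Y = topology_generated_by
     {{f. continuous_map X Y f \<and> f ` K \<subseteq> V} | K V. compactin X K \<and> openin Y V}"

definition CL_top :: "('e::real_vector) topology \<Rightarrow> ('w::real_vector) topology \<Rightarrow> ('e \<Rightarrow> 'w) topology" where
  "CL_top X Y = subtopology (compact_open_topology X Y) {L. linear L \<and> continuous_map X Y L}"

definition has_dir_deriv :: "'w set \<Rightarrow> ('w::real_vector \<Rightarrow> 'w \<Rightarrow> real)
    \<Rightarrow> ('e::real_vector \<Rightarrow> 'w) \<Rightarrow> 'e \<Rightarrow> 'e \<Rightarrow> 'w \<Rightarrow> bool" where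
  "has_dir_deriv Y \<rho> f x h l \<longleftrightarrow>
     limitin (Metric_space.mtopology Y \<rho>) (\<lambda>t. (1 / t) *\<^sub>R (f (x + t *\<^sub>R h) - f x)) l (at (0::real))"

definition dir_deriv :: "'w set \<Rightarrow> ('w::real_vector \<Rightarrow> 'w \<Rightarrow> real)
    \<Rightarrow> ('e::real_vector \<Rightarrow> 'w) \<Rightarrow> 'e \<Rightarrow> 'e \<Rightarrow> 'w" where
  "dir_deriv Y \<rho> f x h = (THE l. has_dir_deriv Y \<rho> f x h l)"

definition C1c_on :: "('e::real_vector \<Rightarrow> 'e \<Rightarrow> real) \<Rightarrow> 'e set
    \<Rightarrow> 'w set \<Rightarrow> ('w::real_vector \<Rightarrow> 'w \<Rightarrow> real) \<Rightarrow> ('e \<Rightarrow> 'w) \<Rightarrow> bool" where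
  "C1c_on \<sigma> U Y \<rho> f \<longleftrightarrow>
     (let E = Metric_space.mtopology UNIV \<sigma>; F = Metric_space.mtopology Y \<rho> in
       openin E U \<and>
       continuous_map (subtopology E U) F f \<and>
       (\<forall>x\<in>U. \<forall>h. \<exists>l. has_dir_deriv Y \<rho> f x h l) \<and>
       continuous_map (subtopology E U) (CL_top E F) (dir_deriv Y \<rho> f))"

definition MC1_on :: "('e::real_vector \<Rightarrow> 'e \<Rightarrow> real) \<Rightarrow> 'e set
    \<Rightarrow> 'w set \<Rightarrow> ('w::real_vector \<Rightarrow> 'w \<Rightarrow> real) \<Rightarrow> ('e \<Rightarrow> 'w) \<Rightarrow> bool" where
  "MC1_on \<sigma> U Y \<rho> f \<longleftrightarrow>
     C1c_on \<sigma> U Y \<rho> f \<and>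
     (\<forall>x\<in>U. dir_deriv Y \<rho> f x \<in> lip_maps \<sigma> Y \<rho>) \<and>
     continuous_map (subtopology (Metric_space.mtopology UNIV \<sigma>) U) (lip_top \<sigma> Y \<rho>) (dir_deriv Y \<rho> f)"

section \<open>\<open>MC\<^sup>k\<close>\<close>

text \<open>The recursion passes from maps into \<open>Y\<close> to maps into a space of linear maps into \<open>Y\<close>, which
  changes the type of the target. All the iterated targets \<open>F\<close>, \<open>L(E,F)\<close>, \<open>L(E,L(E,F))\<close>, and so on are
  therefore realised inside the single vector space \<open>'e list \<Rightarrow> 'f\<close>: an element of \<open>F\<close> is a
  function supported on the empty list, and a linear map \<open>L\<close> into a space that is already realised
  is uncurried to \<open>h # hs \<mapsto> L h hs\<close>. Both embeddings are linear and injective, and metrics are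
  transported along them.\<close>

definition embed0 :: "'f::real_vector \<Rightarrow> 'e list \<Rightarrow> 'f" where
  "embed0 y = (\<lambda>hs. case hs of [] \<Rightarrow> y | _ # _ \<Rightarrow> 0)"

definition uncurry_list :: "('e \<Rightarrow> 'e list \<Rightarrow> 'f::real_vector) \<Rightarrow> 'e list \<Rightarrow> 'f" where
  "uncurry_list L = (\<lambda>hs. case hs of [] \<Rightarrow> 0 | h # hs' \<Rightarrow> L h hs')"

definition curry_list :: "('e list \<Rightarrow> 'f) \<Rightarrow> 'e \<Rightarrow> 'e list \<Rightarrow> 'f" where
  "curry_list w = (\<lambda>h hs. w (h # hs))"

definition lip_component :: "('e::real_vector \<Rightarrow> 'e \<Rightarrow> real) \<Rightarrow> ('e list \<Rightarrow> 'f::real_vector) set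
    \<Rightarrow> (('e list \<Rightarrow> 'f) \<Rightarrow> ('e list \<Rightarrow> 'f) \<Rightarrow> real) \<Rightarrow> ('e list \<Rightarrow> 'f) set" where
  "lip_component \<sigma> Y \<rho> = uncurry_list ` connected_component_of_set (lip_top \<sigma> Y \<rho>) 0"

definition lip_component_dist :: "('e::real_vector \<Rightarrow> 'e \<Rightarrow> real)
    \<Rightarrow> (('e list \<Rightarrow> 'f::real_vector) \<Rightarrow> ('e list \<Rightarrow> 'f) \<Rightarrow> real)
    \<Rightarrow> ('e list \<Rightarrow> 'f) \<Rightarrow> ('e list \<Rightarrow> 'f) \<Rightarrow> real" where
  "lip_component_dist \<sigma> \<rho> v w = lip_dist \<sigma> \<rho> (curry_list v) (curry_list w)"

text \<open>The value at order 0 is only a convention (\<open>MC\<^sup>0\<close> means continuous).\<close>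

fun MC_embedded :: "nat \<Rightarrow> ('e::real_vector \<Rightarrow> 'e \<Rightarrow> real) \<Rightarrow> 'e set
    \<Rightarrow> ('e list \<Rightarrow> 'f::real_vector) set \<Rightarrow> (('e list \<Rightarrow> 'f) \<Rightarrow> ('e list \<Rightarrow> 'f) \<Rightarrow> real)
    \<Rightarrow> ('e \<Rightarrow> 'e list \<Rightarrow> 'f) \<Rightarrow> bool" where
  "MC_embedded 0 \<sigma> U Y \<rho> f \<longleftrightarrow>
     openin (Metric_space.mtopology UNIV \<sigma>) U \<and>
     continuous_map (subtopology (Metric_space.mtopology UNIV \<sigma>) U) (Metric_space.mtopology Y \<rho>) f"
| "MC_embedded (Suc 0) \<sigma> U Y \<rho> f \<longleftrightarrow> MC1_on \<sigma> U Y \<rho> f"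
| "MC_embedded (Suc (Suc k)) \<sigma> U Y \<rho> f \<longleftrightarrow>
     MC1_on \<sigma> U Y \<rho> f \<and>
     (\<forall>V x0. openin (Metric_space.mtopology UNIV \<sigma>) V \<and> connectedin (Metric_space.mtopology UNIV \<sigma>) V \<and>
        V \<subseteq> U \<and> x0 \<in> V \<longrightarrow>
        MC_embedded (Suc k) \<sigma> V (lip_component \<sigma> Y \<rho>) (lip_component_dist \<sigma> \<rho>)
          (\<lambda>x. uncurry_list (dir_deriv Y \<rho> f x - dir_deriv Y \<rho> f x0)))"

definition MC_on :: "nat \<Rightarrow> (nat \<Rightarrow> 'e::real_vector \<Rightarrow> real) \<Rightarrow> (nat \<Rightarrow> 'f::real_vector \<Rightarrow> real)
    \<Rightarrow> 'e set \<Rightarrow> ('e \<Rightarrow> 'f) \<Rightarrow> bool" where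
  "MC_on k p q U f \<longleftrightarrow>
     MC_embedded k (frechet_dist p) U
       (range embed0) (\<lambda>v w. frechet_dist q (v []) (w [])) (\<lambda>x. embed0 (f x))"

section \<open>Manifolds\<close>

text \<open>A chart is a pair of its domain and a function that is relevant on the domain only.\<close>

type_synonym ('m, 'e) chart = "'m set \<times> ('m \<Rightarrow> 'e)"

definition is_chart :: "(nat \<Rightarrow> 'e::real_vector \<Rightarrow> real) \<Rightarrow> 'm topology \<Rightarrow> ('m, 'e) chart \<Rightarrow> bool" where
  "is_chart p M = (\<lambda>(U, \<psi>). openin M U \<and> openin (frechet_top p) (\<psi> ` U) \<and>
     homeomorphic_map (subtopology M U) (subtopology (frechet_top p) (\<psi> ` U)) \<psi>)"

definition MC_manifold :: "nat \<Rightarrow> (nat \<Rightarrow> 'e::real_vector \<Rightarrow> real) \<Rightarrow> 'm topology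
    \<Rightarrow> ('m, 'e) chart set \<Rightarrow> bool" where
  "MC_manifold k p M A \<longleftrightarrow>
     frechet_space p \<and> Hausdorff_space M \<and> second_countable M \<and>
     (\<forall>c\<in>A. is_chart p M c) \<and> (\<Union>(U, \<psi>)\<in>A. U) = topspace M \<and>
     (\<forall>(U, \<psi>)\<in>A. \<forall>(V, \<eta>)\<in>A. MC_on k p p (\<psi> ` (U \<inter> V)) (\<eta> \<circ> inv_into U \<psi>))"

definition local_rep :: "('m, 'e) chart \<Rightarrow> ('n, 'f) chart \<Rightarrow> ('m \<Rightarrow> 'n) \<Rightarrow> 'e \<Rightarrow> 'f" where
  "local_rep c d \<phi> = snd d \<circ> \<phi> \<circ> inv_into (fst c) (snd c)"

definition MC_map :: "nat \<Rightarrow> (nat \<Rightarrow> 'e::real_vector \<Rightarrow> real) \<Rightarrow> 'm topology \<Rightarrow> ('m, 'e) chart set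
    \<Rightarrow> (nat \<Rightarrow> 'f::real_vector \<Rightarrow> real) \<Rightarrow> 'n topology \<Rightarrow> ('n, 'f) chart set
    \<Rightarrow> ('m \<Rightarrow> 'n) \<Rightarrow> bool" where
  "MC_map k p M A q N B \<phi> \<longleftrightarrow>
     continuous_map M N \<phi> \<and>
     (\<forall>c\<in>A. \<forall>d\<in>B. MC_on k p q (snd c ` {x \<in> fst c. \<phi> x \<in> fst d}) (local_rep c d \<phi>))"

section \<open>Lipschitz-Fredholm operators and mappings\<close>

definition finite_dim :: "'a::real_vector set \<Rightarrow> bool" where
  "finite_dim S \<longleftrightarrow> (\<exists>B. finite B \<and> span B = S)"

definition complementary :: "'a::real_vector set \<Rightarrow> 'a set \<Rightarrow> bool" where
  "complementary S C \<longleftrightarrow>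
     subspace S \<and> subspace C \<and> S \<inter> C = {0} \<and> {s + c | s c. s \<in> S \<and> c \<in> C} = UNIV"

text \<open>Codimension is meant algebraically; any two complements of \<open>S\<close> have the same dimension.\<close>

definition finite_codim :: "'a::real_vector set \<Rightarrow> bool" where
  "finite_codim S \<longleftrightarrow> (\<exists>C. complementary S C \<and> finite_dim C)"

definition codim :: "'a::real_vector set \<Rightarrow> nat" where
  "codim S = (THE n. \<exists>C. complementary S C \<and> n = dim C)"

definition kernel :: "('a \<Rightarrow> 'b::real_vector) \<Rightarrow> 'a set" where
  "kernel L = {x. L x = 0}"

definition lipschitz_fredholm :: "(nat \<Rightarrow> 'e::real_vector \<Rightarrow> real) \<Rightarrow> (nat \<Rightarrow> 'f::real_vector \<Rightarrow> real)
    \<Rightarrow> ('e \<Rightarrow> 'f) \<Rightarrow> bool" where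
  "lipschitz_fredholm p q L \<longleftrightarrow>
     L \<in> lip_maps (frechet_dist p) UNIV (frechet_dist q) \<and>
     finite_dim (kernel L) \<and> finite_codim (range L)"

definition fredholm_index :: "('e::real_vector \<Rightarrow> 'f::real_vector) \<Rightarrow> int" where
  "fredholm_index L = int (dim (kernel L)) - int (codim (range L))"

text \<open>The tangent space at a point of the domain of a chart is identified with the model space
  through the chart; this is the derivative at \<open>x\<close> read in the charts \<open>c\<close> and \<open>d\<close>. The Lipschitz
  Fredholm property and the index do not depend on the charts, since the derivatives of transition
  maps are Lipschitz with Lipschitz inverse.\<close>

definition chart_deriv :: "(nat \<Rightarrow> 'f::real_vector \<Rightarrow> real) \<Rightarrow> ('m, 'e::real_vector) chart
    \<Rightarrow> ('n, 'f) chart \<Rightarrow> ('m \<Rightarrow> 'n) \<Rightarrow> 'm \<Rightarrow> 'e \<Rightarrow> 'f" where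
  "chart_deriv q c d \<phi> x = dir_deriv UNIV (frechet_dist q) (local_rep c d \<phi>) (snd c x)"

definition MC_lipschitz_fredholm_map :: "nat \<Rightarrow> (nat \<Rightarrow> 'e::real_vector \<Rightarrow> real) \<Rightarrow> 'm topology
    \<Rightarrow> ('m, 'e) chart set \<Rightarrow> (nat \<Rightarrow> 'f::real_vector \<Rightarrow> real) \<Rightarrow> 'n topology
    \<Rightarrow> ('n, 'f) chart set \<Rightarrow> ('m \<Rightarrow> 'n) \<Rightarrow> bool" where
  "MC_lipschitz_fredholm_map k p M A q N B \<phi> \<longleftrightarrow>
     k \<ge> 1 \<and> MC_map k p M A q N B \<phi> \<and>
     (\<forall>c\<in>A. \<forall>d\<in>B. \<forall>x\<in>fst c. \<phi> x \<in> fst d \<longrightarrow> lipschitz_fredholm p q (chart_deriv q c d \<phi> x))"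

definition has_index :: "('m, 'e::real_vector) chart set \<Rightarrow> (nat \<Rightarrow> 'f::real_vector \<Rightarrow> real)
    \<Rightarrow> ('n, 'f) chart set \<Rightarrow> ('m \<Rightarrow> 'n) \<Rightarrow> int \<Rightarrow> bool" where
  "has_index A q B \<phi> i \<longleftrightarrow>
     (\<forall>c\<in>A. \<forall>d\<in>B. \<forall>x\<in>fst c. \<phi> x \<in> fst d \<longrightarrow> fredholm_index (chart_deriv q c d \<phi> x) = i)"

definition locally_injective :: "'m topology \<Rightarrow> ('m \<Rightarrow> 'n) \<Rightarrow> bool" where
  "locally_injective M \<phi> \<longleftrightarrow> (\<forall>x\<in>topspace M. \<exists>W. openin M W \<and> x \<in> W \<and> inj_on \<phi> W)"

end

(* The Frechet metrics are bounded by 1, so scaling the argument to infinity shows that a linear map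
   with Lipschitz constant below 2^-i takes values in the kernel of the i-th seminorm. Hence the
   spaces of Lipschitz linear maps are totally disconnected, and already an MC^1 map is locally
   affine. In charts, a locally injective Lipschitz-Fredholm map of index zero is thus locally a
   translate of an injective linear map; the index makes this linear map surjective, and the
   open mapping theorem for Frechet spaces (Baire category) makes it open. *)
theory Submission
  imports Defs
begin

text \<open>The obstacle is that continuity of the derivative controls it one seminorm at a time:
  the radius on which it is constant modulo \<open>q i\<close> depends on \<open>i\<close>, and
  continuity alone offers no common radius. So \<open>i\<close> is fixed and a segment is
  considered. Having the same derivative modulo \<open>q i\<close> is an equivalence relation with
  open classes on the segment, and connectedness leaves only one class, however small the radii are.
  This makes the map affine along the segment modulo every \<open>q i\<close>, hence exactly. Balls
  of the metric are star-shaped about their centre, so any ball inside the domain will do, and its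
  radius no longer depends on \<open>i\<close>.

  Both completeness assumptions enter through the open mapping theorem: that of the target through
  Baire category, that of the source through convergence of the successive corrections.\<close>

section \<open>Translation-invariant metrics on additive subgroups\<close>

text \<open>A common interface for the metric of a Frechet space, its copy on
  \<open>range embed0\<close>, and the Lipschitz distance; the carrier \<open>Y\<close> is there for
  the last two. Nonnegativity and symmetry are demanded off \<open>Y\<close> as well because
  \<open>Metric_space\<close> demands them at all points.\<close>

locale group_norm =
  fixes Y :: "'a::ab_group_add set" and \<nu> :: "'a \<Rightarrow> real"
  assumes zero_mem: "0 \<in> Y"
    and diff_mem: "\<lbrakk>x \<in> Y; y \<in> Y\<rbrakk> \<Longrightarrow> x - y \<in> Y"
    and norm_nonneg: "0 \<le> \<nu> x"
    and norm_minus: "\<nu> (- x) = \<nu> x"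
    and norm_add: "\<lbrakk>x \<in> Y; y \<in> Y\<rbrakk> \<Longrightarrow> \<nu> (x + y) \<le> \<nu> x + \<nu> y"
    and norm_eq_0: "x \<in> Y \<Longrightarrow> \<nu> x = 0 \<longleftrightarrow> x = 0"
begin

lemma norm_zero: "\<nu> 0 = 0"
  by (simp add: norm_eq_0 zero_mem)

lemma norm_diff_commute: "\<nu> (x - y) = \<nu> (y - x)"
  using norm_minus[of "x - y"] by simp

lemma minus_mem: "x \<in> Y \<Longrightarrow> - x \<in> Y"
  using diff_mem[OF zero_mem] by simp

lemma norm_diff: "\<lbrakk>x \<in> Y; y \<in> Y\<rbrakk> \<Longrightarrow> \<nu> (x - y) \<le> \<nu> x + \<nu> y"
  using norm_add[of x "- y"] by (simp add: norm_minus minus_mem)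

sublocale Metric_space Y "\<lambda>x y. \<nu> (x - y)"
proof
  show "\<nu> (x - z) = 0 \<longleftrightarrow> x = z" if "x \<in> Y" "z \<in> Y" for x z
    using that by (simp add: norm_eq_0 diff_mem)
  show "\<nu> (x - z) \<le> \<nu> (x - y) + \<nu> (y - z)" if "x \<in> Y" "y \<in> Y" "z \<in> Y" for x y z
    using norm_add[of "x - y" "y - z"] that by (simp add: diff_mem)
qed (auto intro: norm_nonneg norm_diff_commute)

end

section \<open>The metric of a Frechet space\<close>

text \<open>Distance to 0 in \<open>frechet_dist\<close>. It is bounded, hence not homogeneous;
  \<open>fnorm_scaleR_mono\<close> and \<open>fnorm_scaleR_small\<close> serve in place of
  homogeneity.\<close>

definition fnorm :: "(nat \<Rightarrow> 'a::real_vector \<Rightarrow> real) \<Rightarrow> 'a \<Rightarrow> real" where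
  "fnorm p x = (SUP n. 1 / 2 ^ n * (p n x / (1 + p n x)))"

lemma frechet_dist_eq_fnorm: "frechet_dist p = (\<lambda>x y. fnorm p (x - y))"
  by (simp add: frechet_dist_def fnorm_def fun_eq_iff)

lemma frac_mono: "\<lbrakk>0 \<le> s; s \<le> t\<rbrakk> \<Longrightarrow> s / (1 + s) \<le> t / (1 + t)" for s t :: real
  by (simp add: divide_simps algebra_simps)

lemma frac_add:
  fixes s t u :: real
  assumes "0 \<le> s" "0 \<le> t" "u \<le> s + t" "0 \<le> u"
  shows "u / (1 + u) \<le> s / (1 + s) + t / (1 + t)"
proof -
  have "u / (1 + u) \<le> (s + t) / (1 + (s + t))"
    by (rule frac_mono) (use assms in auto)
  also have "\<dots> = s / (1 + (s + t)) + t / (1 + (s + t))"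
    by (simp add: add_divide_distrib)
  also have "\<dots> \<le> s / (1 + s) + t / (1 + t)"
    by (intro add_mono divide_left_mono mult_pos_pos) (use assms in auto)
  finally show ?thesis .
qed

lemma frac_le: "0 \<le> s \<Longrightarrow> s / (1 + s) \<le> min s 1" for s :: real
  by (auto simp: field_simps)

locale seminorms =
  fixes p :: "nat \<Rightarrow> 'a::real_vector \<Rightarrow> real"
  assumes seminorm: "is_seminorm (p n)"
begin

lemma seminorm_nonneg: "0 \<le> p n x"
  and seminorm_add: "p n (x + y) \<le> p n x + p n y"
  and seminorm_scaleR: "p n (c *\<^sub>R x) = \<bar>c\<bar> * p n x"
  using seminorm[of n] unfolding is_seminorm_def by auto

lemma seminorm_zero: "p n 0 = 0"
  using seminorm_scaleR[of n 0 0] by simp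

lemma seminorm_minus: "p n (- x) = p n x"
  using seminorm_scaleR[of n "-1" x] by simp

lemma seminorm_diff: "p n (x - y) \<le> p n x + p n y"
  using seminorm_add[of n x "- y"] by (simp add: seminorm_minus)

lemma fnorm_term_le: "1 / 2 ^ n * (p n x / (1 + p n x)) \<le> 1 / 2 ^ n"
  using mult_left_mono[of "p n x / (1 + p n x)" 1 "1 / 2 ^ n"] frac_le[OF seminorm_nonneg[of n x]] by simp

lemma fnorm_upper: "1 / 2 ^ n * (p n x / (1 + p n x)) \<le> fnorm p x"
  unfolding fnorm_def
proof (rule cSUP_upper)
  have "1 / 2 ^ n * (p n x / (1 + p n x)) \<le> 1" for n
    using fnorm_term_le[of n x] by (rule order_trans) simp
  then show "bdd_above (range (\<lambda>n. 1 / 2 ^ n * (p n x / (1 + p n x))))"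
    by (intro bdd_aboveI2[where M = 1])
qed simp

lemma fnorm_least: "(\<And>n. 1 / 2 ^ n * (p n x / (1 + p n x)) \<le> b) \<Longrightarrow> fnorm p x \<le> b"
  unfolding fnorm_def by (rule cSUP_least) auto

lemma fnorm_nonneg: "0 \<le> fnorm p x"
  by (rule order_trans[OF _ fnorm_upper[of 0]]) (simp add: seminorm_nonneg)

lemma fnorm_le_1: "fnorm p x \<le> 1"
  by (rule fnorm_least, rule order_trans[OF fnorm_term_le]) simp

lemma fnorm_minus: "fnorm p (- x) = fnorm p x"
  by (simp add: fnorm_def seminorm_minus)

lemma fnorm_zero: "fnorm p 0 = 0"
  by (simp add: fnorm_def seminorm_zero)

lemma fnorm_add: "fnorm p (x + y) \<le> fnorm p x + fnorm p y"
proof (rule fnorm_least)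
  fix n
  have "1 / 2 ^ n * (p n (x + y) / (1 + p n (x + y)))
      \<le> 1 / 2 ^ n * (p n x / (1 + p n x) + p n y / (1 + p n y))"
    by (intro mult_left_mono frac_add seminorm_nonneg seminorm_add) simp
  also have "\<dots> \<le> fnorm p x + fnorm p y"
    using fnorm_upper[of n x] fnorm_upper[of n y] by (simp add: distrib_left)
  finally show "1 / 2 ^ n * (p n (x + y) / (1 + p n (x + y))) \<le> fnorm p x + fnorm p y" .
qed

text \<open>Balls about 0 are therefore balanced: segments from the centre of a ball stay inside,
  and division by a number of modulus at least 1 preserves smallness.\<close>

lemma fnorm_scaleR_mono:
  assumes "\<bar>c\<bar> \<le> \<bar>d\<bar>"
  shows "fnorm p (c *\<^sub>R x) \<le> fnorm p (d *\<^sub>R x)"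
proof (rule fnorm_least)
  fix n
  have "1 / 2 ^ n * (p n (c *\<^sub>R x) / (1 + p n (c *\<^sub>R x)))
      \<le> 1 / 2 ^ n * (p n (d *\<^sub>R x) / (1 + p n (d *\<^sub>R x)))"
    using mult_right_mono[OF assms seminorm_nonneg[of n x]]
    by (intro mult_left_mono frac_mono) (auto simp: seminorm_scaleR seminorm_nonneg)
  then show "1 / 2 ^ n * (p n (c *\<^sub>R x) / (1 + p n (c *\<^sub>R x))) \<le> fnorm p (d *\<^sub>R x)"
    using fnorm_upper by (rule order_trans)
qed

text \<open>The threshold is the \<open>n\<close>-th term of the supremum at seminorm value
  \<open>e\<close>, and this term increases with the seminorm.\<close>

lemma fnorm_less_imp_seminorm_less:
  assumes "e > 0" "fnorm p x < 1 / 2 ^ n * (e / (1 + e))"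
  shows "p n x < e"
proof (rule ccontr)
  assume "\<not> p n x < e"
  then have "1 / 2 ^ n * (e / (1 + e)) \<le> 1 / 2 ^ n * (p n x / (1 + p n x))"
    using assms(1) by (intro mult_left_mono frac_mono) auto
  with fnorm_upper[of n x] assms(2) show False by linarith
qed

text \<open>The terms from index \<open>K\<close> on are below \<open>e / 2\<close> for every
  \<open>t\<close>; the finitely many others are at most \<open>\<bar>t\<bar> * S\<close>. Dividing
  by \<open>1 + S\<close> covers the case \<open>S = 0\<close>.\<close>

lemma fnorm_scaleR_small:
  assumes "e > 0"
  obtains d where "d > 0" "\<And>t. \<bar>t\<bar> < d \<Longrightarrow> fnorm p (t *\<^sub>R x) < e"
proof -
  obtain K where K: "1 / 2 ^ K < e / 2"
    using real_arch_pow_inv[of "e/2" "1/2"] assms by (auto simp: power_one_over)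
  define S where "S = (\<Sum>n<K. p n x)"
  have S: "S \<ge> 0" unfolding S_def by (intro sum_nonneg seminorm_nonneg)
  show thesis
  proof (rule that)
    show "e / 2 / (1 + S) > 0" using S assms by simp
    fix t :: real assume t: "\<bar>t\<bar> < e / 2 / (1 + S)"
    have "fnorm p (t *\<^sub>R x) \<le> e / 2"
    proof (rule fnorm_least)
      fix n
      show "1 / 2 ^ n * (p n (t *\<^sub>R x) / (1 + p n (t *\<^sub>R x))) \<le> e / 2"
      proof (cases "n < K")
        case True
        then have "p n x \<le> S"
          unfolding S_def by (intro member_le_sum) (auto simp: seminorm_nonneg)
        have "1 / 2 ^ n * (p n (t *\<^sub>R x) / (1 + p n (t *\<^sub>R x))) \<le> 1 * p n (t *\<^sub>R x)"
          using frac_le[OF seminorm_nonneg[of n "t *\<^sub>R x"]]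
          by (intro mult_mono) (auto simp: seminorm_nonneg)
        also have "\<dots> = \<bar>t\<bar> * p n x" by (simp add: seminorm_scaleR)
        also have "\<dots> \<le> (e / 2 / (1 + S)) * (1 + S)"
          by (intro mult_mono) (use t \<open>p n x \<le> S\<close> S assms seminorm_nonneg in auto)
        also have "\<dots> = e / 2"
          using S nonzero_divide_eq_eq[of "1 + S" "e / 2" "e / 2 / (1 + S)"] by simp
        finally show ?thesis .
      next
        case False
        have "1 / 2 ^ n * (p n (t *\<^sub>R x) / (1 + p n (t *\<^sub>R x))) \<le> (1::real) / 2 ^ n"
          by (rule fnorm_term_le)
        also have "\<dots> \<le> 1 / 2 ^ K" using False by (intro divide_left_mono power_increasing) auto
        finally show ?thesis using K by linarith
      qed
    qed
    then show "fnorm p (t *\<^sub>R x) < e" using assms by linarith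
  qed
qed

end

locale frechet = seminorms p for p :: "nat \<Rightarrow> 'a::real_vector \<Rightarrow> real" +
  assumes separating: "(\<And>n. p n x = 0) \<Longrightarrow> x = 0"
    and complete: "Metric_space.mcomplete UNIV (\<lambda>x y. fnorm p (x - y))"
begin

sublocale group_norm UNIV "fnorm p"
proof
  fix x
  have "p n x = 0" if "fnorm p x = 0" for n
  proof (rule antisym[OF _ seminorm_nonneg], rule field_le_epsilon)
    fix e :: real assume "e > 0"
    then show "p n x \<le> 0 + e"
      using fnorm_less_imp_seminorm_less[of e x n] that by simp
  qed
  then show "fnorm p x = 0 \<longleftrightarrow> x = 0"
    using separating fnorm_zero by blast
qed (auto simp: fnorm_nonneg fnorm_minus fnorm_add)

end

lemma frechet_space_iff: "frechet_space p \<longleftrightarrow> frechet p"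
  by (auto simp: frechet_space_def frechet_def seminorms_def frechet_axioms_def frechet_dist_eq_fnorm)

section \<open>Lipschitz linear maps\<close>

lemma (in seminorms) bounded_linear_imp_seminorm_zero:
  assumes L: "linear L" and bound: "\<And>x. fnorm p (L x) \<le> l" and l: "l < 1 / 2 ^ i"
  shows "p i (L x) = 0"
proof (rule ccontr)
  assume "p i (L x) \<noteq> 0"
  then have c: "p i (L x) > 0" using seminorm_nonneg[of i "L x"] by linarith
  define a where "a = 2 ^ i * l"
  have a: "a < 1" using l by (simp add: a_def field_simps)
  \<comment> \<open>Rescaling \<open>x\<close> gives the seminorm any value \<open>u > 0\<close>,
    and the bound then demands \<open>u * (1 - a) \<le> a < 1\<close>. The choice
    \<open>u * (1 - a) = 2\<close> violates this.\<close>
  define u where "u = 2 / (1 - a)"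
  have u: "u > 0" and ua: "u * (1 - a) = 2"
    using a nonzero_divide_eq_eq[of "1 - a" 2 u] by (simp_all add: u_def)
  have "p i (L ((u / p i (L x)) *\<^sub>R x)) = u"
    using c u by (simp add: linear_scale[OF L] seminorm_scaleR)
  then have "1 / 2 ^ i * (u / (1 + u)) \<le> l"
    using order_trans[OF fnorm_upper[of i "L ((u / p i (L x)) *\<^sub>R x)"] bound] by simp
  then have "u \<le> l * (2 ^ i * (1 + u))"
    using u pos_divide_le_eq[of "2 ^ i * (1 + u)" u l] by simp
  then have "u \<le> a * (1 + u)" by (simp add: a_def ac_simps)
  with ua a show False by (simp add: algebra_simps)
qed

locale two_norms = src: group_norm UNIV s + tgt: group_norm Y \<nu>
  for s :: "'e::real_vector \<Rightarrow> real" and Y :: "'w::real_vector set" and \<nu> :: "'w \<Rightarrow> real"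
begin

abbreviation "Lip' \<equiv> Lip (\<lambda>x y. s (x - y)) (\<lambda>v w. \<nu> (v - w))"
abbreviation "maps \<equiv> lip_maps (\<lambda>x y. s (x - y)) Y (\<lambda>v w. \<nu> (v - w))"

lemma Lip_least:
  assumes "\<And>x. \<nu> (L x) \<le> C * s x"
  shows "Lip' L \<le> ennreal C"
  unfolding Lip_def
proof (rule SUP_least)
  fix x :: 'e assume "x \<in> UNIV - {0}"
  then have "s x > 0" using src.norm_eq_0[of x] src.norm_nonneg[of x] by auto
  then show "ennreal (\<nu> (L x - 0) / s (x - 0)) \<le> ennreal C"
    using assms[of x] by (intro ennreal_leI) (simp add: field_simps)
qed

text \<open>Finiteness matters: \<open>enn2real\<close> sends an infinite Lipschitz constant to
  0.\<close>

lemma Lip_upper: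
  assumes "linear L" "Lip' L < \<infinity>"
  shows "\<nu> (L x) \<le> enn2real (Lip' L) * s x"
proof (cases "x = 0")
  case True
  then show ?thesis by (simp add: linear_0[OF assms(1)] src.norm_zero tgt.norm_zero)
next
  case False
  then have "s x > 0" using src.norm_eq_0[of x] src.norm_nonneg[of x] by auto
  have "ennreal (\<nu> (L x) / s x) \<le> Lip' L"
    unfolding Lip_def using False by (intro SUP_upper2[of x]) auto
  then have "\<nu> (L x) / s x \<le> enn2real (Lip' L)"
    using assms(2) \<open>s x > 0\<close> enn2real_mono[of "ennreal (\<nu> (L x) / s x)" "Lip' L"]
    by (simp add: tgt.norm_nonneg)
  with \<open>s x > 0\<close> show ?thesis by (simp add: field_simps)
qed

lemma maps_bound: "L \<in> maps \<Longrightarrow> \<nu> (L x) \<le> enn2real (Lip' L) * s x"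
  by (rule Lip_upper) (auto simp: lip_maps_def)

lemma mapsI:
  assumes "linear L" "range L \<subseteq> Y" "\<And>x. \<nu> (L x) \<le> C * s x"
  shows "L \<in> maps"
  using assms order_le_less_trans[OF Lip_least[OF assms(3)] ennreal_less_top]
  by (simp add: lip_maps_def)

lemma enn2real_Lip_le:
  assumes "\<And>x. \<nu> (L x) \<le> C * s x" "0 \<le> C"
  shows "enn2real (Lip' L) \<le> C"
  using enn2real_mono[OF Lip_least[OF assms(1)]] assms(2) by simp

text \<open>The Lipschitz maps form an instance of the same interface, so \<open>lip_top\<close> is
  a metric topology and continuity of a derivative can be read off in balls.\<close>

sublocale lip: group_norm maps "\<lambda>L. enn2real (Lip' L)"
proof
  show "0 \<in> maps"
    by (rule mapsI[where C = 0]) (auto simp: tgt.norm_zero tgt.zero_mem linear_iff)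
next
  fix L H assume LH: "L \<in> maps" "H \<in> maps"
  let ?C = "enn2real (Lip' L) + enn2real (Lip' H)"
  have mem: "L x \<in> Y" "H x \<in> Y" for x using LH by (auto simp: lip_maps_def)
  have lin: "linear L" "linear H" using LH by (auto simp: lip_maps_def)
  have "\<nu> ((L - H) x) \<le> ?C * s x" for x
    using tgt.norm_diff[OF mem, of x x] maps_bound[OF LH(1), of x] maps_bound[OF LH(2), of x]
    by (simp add: algebra_simps)
  moreover have "linear (L - H)"
    using linear_compose_sub[OF lin] by (simp add: fun_diff_def)
  ultimately show "L - H \<in> maps"
    using tgt.diff_mem mem by (intro mapsI[where C = ?C]) auto
  show "enn2real (Lip' (L + H)) \<le> ?C"
  proof (rule enn2real_Lip_le)
    show "\<nu> ((L + H) x) \<le> ?C * s x" for x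
      using tgt.norm_add[OF mem, of x x] maps_bound[OF LH(1), of x] maps_bound[OF LH(2), of x]
      by (simp add: algebra_simps)
  qed simp
next
  fix L
  have "Lip' (- L) = Lip' L"
    unfolding Lip_def by (simp add: tgt.norm_minus)
  then show "enn2real (Lip' (- L)) = enn2real (Lip' L)" by simp
next
  fix L assume L: "L \<in> maps"
  show "enn2real (Lip' L) = 0 \<longleftrightarrow> L = 0"
  proof
    assume "enn2real (Lip' L) = 0"
    with maps_bound[OF L] have "\<nu> (L x) = 0" for x
      using tgt.norm_nonneg[of "L x"] by (metis antisym mult_zero_left)
    moreover have "L x \<in> Y" for x using L by (auto simp: lip_maps_def)
    ultimately show "L = 0" by (auto simp: tgt.norm_eq_0 fun_eq_iff)
  next
    assume "L = 0"
    then have "enn2real (Lip' L) \<le> 0"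
      by (intro enn2real_Lip_le) (auto simp: tgt.norm_zero)
    then show "enn2real (Lip' L) = 0" by (simp add: antisym)
  qed
qed simp

end

text \<open>As \<open>U\<close> is open in the whole space, one radius secures both membership in
  \<open>U\<close> and closeness of the values.\<close>

lemma (in Metric_space) continuous_map_mball:
  assumes "Metric_space N d'" "openin mtopology U"
    and "continuous_map (subtopology mtopology U) (Metric_space.mtopology N d') g"
    and "x \<in> U" "e > 0"
  obtains r where "r > 0" "\<And>y. \<lbrakk>y \<in> M; d x y < r\<rbrakk> \<Longrightarrow> y \<in> U \<and> g y \<in> N \<and> d' (g x) (g y) < e"
proof -
  interpret N: Metric_space N d' by fact
  have UM: "U \<subseteq> M" using openin_subset[OF assms(2)] by simp
  have "openin (subtopology mtopology U) {y \<in> topspace (subtopology mtopology U). g y \<in> N.mball (g x) e}"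
    using assms(3) N.openin_mball by (rule openin_continuous_map_preimage)
  then have op: "openin mtopology {y \<in> topspace (subtopology mtopology U). g y \<in> N.mball (g x) e}"
    using assms(2) by (simp only: openin_open_subtopology)
  have "g x \<in> N"
    using assms(3,4) UM by (auto simp: continuous_map_def)
  then have "x \<in> {y \<in> topspace (subtopology mtopology U). g y \<in> N.mball (g x) e}"
    using assms(4,5) UM by auto
  with op obtain r where r: "r > 0" "mball x r \<subseteq> {y \<in> topspace (subtopology mtopology U). g y \<in> N.mball (g x) e}"
    unfolding openin_mtopology by blast
  show thesis
  proof (rule that[OF r(1)])
    fix y assume "y \<in> M" "d x y < r"
    then have "y \<in> mball x r" using assms(4) UM by auto
    with r(2) show "y \<in> U \<and> g y \<in> N \<and> d' (g x) (g y) < e" by auto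
  qed
qed

section \<open>The realisation of the target inside functions on lists\<close>

lemma embed0_Nil [simp]: "embed0 y [] = y"
  by (simp add: embed0_def)

lemma embed0_diff: "embed0 (x - y) = embed0 x - embed0 y"
  and embed0_scaleR: "embed0 (c *\<^sub>R x) = c *\<^sub>R embed0 x"
  and embed0_0: "embed0 0 = 0"
  by (auto simp: embed0_def scaleR_fun_def fun_eq_iff split: list.split)

text \<open>Evaluation at the empty list determines an element of \<open>range embed0\<close>, so
  the norm separates points there, though not on all functions of lists.\<close>

lemma (in frechet) group_norm_embed0: "group_norm (range embed0) (\<lambda>v. fnorm p (v []))"
proof
  show "v - w \<in> range embed0" if "v \<in> range embed0" "w \<in> range embed0" for v w :: "'b list \<Rightarrow> 'a"
    using that by (auto simp flip: embed0_diff)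
  show "0 \<in> range (embed0 :: 'a \<Rightarrow> 'b list \<Rightarrow> 'a)"
    by (metis embed0_0 rangeI)
qed (auto simp: norm_nonneg norm_minus norm_add norm_eq_0 embed0_0)

section \<open>Local affinity\<close>

locale frechet_pair = E: frechet p + F: frechet q
  for p :: "nat \<Rightarrow> 'e::real_vector \<Rightarrow> real" and q :: "nat \<Rightarrow> 'f::real_vector \<Rightarrow> real"
begin

lemma has_dir_deriv_iff:
  "has_dir_deriv UNIV (frechet_dist q) f x h l \<longleftrightarrow>
    (\<forall>e>0. \<forall>\<^sub>F t in at 0. fnorm q ((1 / t) *\<^sub>R (f (x + t *\<^sub>R h) - f x) - l) < e)"
  unfolding has_dir_deriv_def frechet_dist_eq_fnorm F.limitin_metric by simp

lemma dir_deriv_eqI: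
  assumes "has_dir_deriv UNIV (frechet_dist q) f x h l"
  shows "dir_deriv UNIV (frechet_dist q) f x h = l"
  unfolding dir_deriv_def
proof (rule the_equality)
  show "l' = l" if "has_dir_deriv UNIV (frechet_dist q) f x h l'" for l'
    using assms that unfolding has_dir_deriv_def frechet_dist_eq_fnorm
    by (intro F.limitin_metric_unique[of _ l' "at (0::real)" l]) auto
qed (rule assms)

lemma dist_embed0:
  "(\<lambda>v w. frechet_dist q (v []) (w [])) = (\<lambda>v w. fnorm q ((v - w) []))"
  by (simp add: frechet_dist_eq_fnorm)

text \<open>Difference quotients commute with the linear \<open>embed0\<close>, and a limit has to
  lie in the carrier \<open>range embed0\<close>.\<close>

lemma has_dir_deriv_embed0_iff:
  fixes f :: "'e \<Rightarrow> 'f"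
  shows "has_dir_deriv (range embed0) (\<lambda>v w. frechet_dist q (v []) (w []))
      (\<lambda>x. embed0 (f x) :: 'e list \<Rightarrow> 'f) x h w \<longleftrightarrow>
    (\<exists>l. w = embed0 l \<and> has_dir_deriv UNIV (frechet_dist q) f x h l)"
proof -
  interpret X: group_norm "range embed0" "\<lambda>v :: 'e list \<Rightarrow> 'f. fnorm q (v [])"
    by (rule F.group_norm_embed0)
  show ?thesis
    unfolding has_dir_deriv_iff unfolding has_dir_deriv_def dist_embed0 X.limitin_metric
    by (auto simp flip: embed0_diff embed0_scaleR)
qed

lemma dir_deriv_embed0:
  fixes f :: "'e \<Rightarrow> 'f"
  assumes "has_dir_deriv UNIV (frechet_dist q) f x h l"
  shows "dir_deriv (range embed0) (\<lambda>v w. frechet_dist q (v []) (w []))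
      (\<lambda>x. embed0 (f x) :: 'e list \<Rightarrow> 'f) x h = embed0 l"
  unfolding dir_deriv_def has_dir_deriv_embed0_iff
proof (rule the_equality)
  show "w = embed0 l" if "\<exists>l. w = embed0 l \<and> has_dir_deriv UNIV (frechet_dist q) f x h l"
    for w :: "'e list \<Rightarrow> 'f"
    using that assms dir_deriv_eqI by metis
qed (use assms in blast)

context
  fixes k :: nat and U :: "'e set" and f :: "'e \<Rightarrow> 'f"
  assumes k: "k \<ge> 1" and MC: "MC_on k p q U f"
begin

abbreviation "D \<equiv> dir_deriv UNIV (frechet_dist q) f"

text \<open>Both recursive clauses of positive order contain the \<open>MC1_on\<close> conjunct;
  \<open>k \<ge> 1\<close> excludes order 0, which means mere continuity.\<close>

lemma MC_on_imp_MC1_on: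
  "MC1_on (frechet_dist p) U (range embed0) (\<lambda>v w. frechet_dist q (v []) (w []))
     (\<lambda>x. embed0 (f x) :: 'e list \<Rightarrow> 'f)"
proof -
  consider "k = Suc 0" | j where "k = Suc (Suc j)"
    using k by (metis One_nat_def Suc_le_D not0_implies_Suc)
  then show ?thesis using MC unfolding MC_on_def by cases auto
qed

lemma MC_on_openin: "openin E.mtopology U"
  using MC_on_imp_MC1_on unfolding MC1_on_def C1c_on_def Let_def frechet_dist_eq_fnorm by blast

lemma MC_on_has_dir_deriv:
  assumes "x \<in> U"
  shows "has_dir_deriv UNIV (frechet_dist q) f x h (D x h)"
proof -
  obtain w where "has_dir_deriv (range embed0) (\<lambda>v w. frechet_dist q (v []) (w []))
      (\<lambda>x. embed0 (f x) :: 'e list \<Rightarrow> 'f) x h w"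
    using MC_on_imp_MC1_on assms unfolding MC1_on_def C1c_on_def Let_def by blast
  then show ?thesis
    unfolding has_dir_deriv_embed0_iff using dir_deriv_eqI by blast
qed

text \<open>Near \<open>x\<close> the Lipschitz constant of the difference of the derivatives is
  below \<open>1 / 2 ^ i\<close>, which forces its values into the kernel of \<open>q i\<close>. The
  radius depends on \<open>i\<close>.\<close>

lemma MC_on_deriv_locally_const:
  assumes "x \<in> U"
  obtains r where "r > 0" "\<And>y. fnorm p (y - x) < r \<Longrightarrow> y \<in> U"
    "\<And>y h. fnorm p (y - x) < r \<Longrightarrow> q i (D y h - D x h) = 0"
proof -
  interpret X: group_norm "range embed0" "\<lambda>v :: 'e list \<Rightarrow> 'f. fnorm q (v [])"
    by (rule F.group_norm_embed0)
  interpret N: two_norms "fnorm p" "range embed0" "\<lambda>v :: 'e list \<Rightarrow> 'f. fnorm q (v [])" ..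
  let ?D = "dir_deriv (range embed0) (\<lambda>v w. fnorm q ((v - w) [])) (\<lambda>x. embed0 (f x) :: 'e list \<Rightarrow> 'f)"
  have D: "?D y h = embed0 (D y h)" if "y \<in> U" for y h
    using dir_deriv_embed0[OF MC_on_has_dir_deriv[OF that]] by (simp add: dist_embed0)
  have "continuous_map (subtopology E.mtopology U) N.lip.mtopology ?D"
    using MC_on_imp_MC1_on unfolding MC1_on_def dist_embed0 unfolding frechet_dist_eq_fnorm lip_top_def
      lip_dist_def by blast
  from E.continuous_map_mball[OF N.lip.Metric_space_axioms MC_on_openin this assms, of "1 / 2 ^ i"]
  obtain r where r: "r > 0"
    and *: "\<And>y. fnorm p (x - y) < r \<Longrightarrow> y \<in> U \<and> ?D y \<in> N.maps
              \<and> enn2real (N.Lip' (?D x - ?D y)) < 1 / 2 ^ i"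
    by auto
  show thesis
  proof (rule that[OF r])
    show "y \<in> U" if "fnorm p (y - x) < r" for y
      using * that by (simp add: E.norm_diff_commute)
    show "q i (D y h - D x h) = 0" if "fnorm p (y - x) < r" for y h
    proof -
      have y: "y \<in> U" "?D y \<in> N.maps" "?D x \<in> N.maps" "enn2real (N.Lip' (?D y - ?D x)) < 1 / 2 ^ i"
        using *[of y] *[of x] that r N.lip.norm_diff_commute[of "?D x" "?D y"]
        by (simp_all add: E.norm_diff_commute E.norm_zero)
      then have maps: "?D y - ?D x \<in> N.maps" by (intro N.lip.diff_mem)
      define L where "L h = (?D y - ?D x) h []" for h
      have L: "L h = D y h - D x h" for h
        using D assms y(1) by (simp add: L_def)
      have "linear L"
        using maps by (auto simp: lip_maps_def linear_iff L_def scaleR_fun_def)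
      moreover have "fnorm q (L h) \<le> enn2real (N.Lip' (?D y - ?D x))" for h
      proof -
        have "fnorm q (L h) \<le> enn2real (N.Lip' (?D y - ?D x)) * fnorm p h"
          using N.maps_bound[OF maps] by (simp add: L_def)
        \<comment> \<open>Since the source metric is bounded by 1, the Lipschitz constant bounds all
          values of \<open>L\<close>.\<close>
        also have "\<dots> \<le> enn2real (N.Lip' (?D y - ?D x)) * 1"
          by (intro mult_left_mono E.fnorm_le_1) simp
        finally show ?thesis by simp
      qed
      ultimately have "q i (L h) = 0"
        using y(4) by (rule F.bounded_linear_imp_seminorm_zero)
      then show ?thesis by (simp add: L)
    qed
  qed
qed

text \<open>Equality of derivatives modulo \<open>q i\<close> is an equivalence relation on the
  parameters in [0,1] with relatively open classes, and [0,1] is connected.\<close>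

lemma segment_deriv_const:
  assumes "\<And>t. t \<in> {0..1} \<Longrightarrow> x + t *\<^sub>R h \<in> U" "t \<in> {0..1}"
  shows "q i (D (x + t *\<^sub>R h) v - D x v) = 0"
proof -
  have "connected {0..1::real}" by simp
  then have "q i (D (x + 0 *\<^sub>R h) v - D (x + t *\<^sub>R h) v) = 0"
  proof (rule connected_equivalence_relation[where a = 0 and b = t
        and R = "\<lambda>s u. q i (D (x + s *\<^sub>R h) v - D (x + u *\<^sub>R h) v) = 0"])
    fix s u
    assume "q i (D (x + s *\<^sub>R h) v - D (x + u *\<^sub>R h) v) = 0"
    then show "q i (D (x + u *\<^sub>R h) v - D (x + s *\<^sub>R h) v) = 0"
      using F.seminorm_minus[of i "D (x + s *\<^sub>R h) v - D (x + u *\<^sub>R h) v"] by simp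
  next
    fix s u w
    assume "q i (D (x + s *\<^sub>R h) v - D (x + u *\<^sub>R h) v) = 0"
      "q i (D (x + u *\<^sub>R h) v - D (x + w *\<^sub>R h) v) = 0"
    then show "q i (D (x + s *\<^sub>R h) v - D (x + w *\<^sub>R h) v) = 0"
      using F.seminorm_add[of i "D (x + s *\<^sub>R h) v - D (x + u *\<^sub>R h) v"
          "D (x + u *\<^sub>R h) v - D (x + w *\<^sub>R h) v"]
        F.seminorm_nonneg[of i "D (x + s *\<^sub>R h) v - D (x + w *\<^sub>R h) v"] by simp
  next
    fix s :: real assume "s \<in> {0..1}"
    then have "x + s *\<^sub>R h \<in> U" by (rule assms(1))
    then obtain r where r: "r > 0"
      "\<And>y. fnorm p (y - (x + s *\<^sub>R h)) < r \<Longrightarrow> q i (D y v - D (x + s *\<^sub>R h) v) = 0"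
      using MC_on_deriv_locally_const by metis
    obtain d where d: "d > 0" "\<And>t. \<bar>t\<bar> < d \<Longrightarrow> fnorm p (t *\<^sub>R h) < r"
      using E.fnorm_scaleR_small[OF r(1)] by blast
    have "q i (D (x + s *\<^sub>R h) v - D (x + u *\<^sub>R h) v) = 0" if "u \<in> ball s d" for u
    proof -
      have "x + u *\<^sub>R h - (x + s *\<^sub>R h) = (u - s) *\<^sub>R h" by (simp add: algebra_simps)
      then have "q i (D (x + u *\<^sub>R h) v - D (x + s *\<^sub>R h) v) = 0"
        using d(2)[of "u - s"] that by (intro r(2)) (auto simp: dist_real_def)
      then show ?thesis
        using F.seminorm_minus[of i "D (x + u *\<^sub>R h) v - D (x + s *\<^sub>R h) v"] by simp
    qed
    then show "\<exists>T. openin (top_of_set {0..1}) T \<and> s \<in> T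
        \<and> (\<forall>u\<in>T. q i (D (x + s *\<^sub>R h) v - D (x + u *\<^sub>R h) v) = 0)"
      using \<open>s \<in> {0..1}\<close> d(1)
      by (intro exI[of _ "{0..1} \<inter> ball s d"]) (auto intro: openin_open_Int)
  qed (use assms(2) in auto)
  then show ?thesis
    using F.seminorm_minus[of i "D x v - D (x + t *\<^sub>R h) v"] by simp
qed

text \<open>Composing the deviation from the affine candidate with \<open>q i\<close> reduces the
  claim to real analysis: a real function with derivative 0 on [0,1] is constant, and this one
  vanishes at 0.\<close>

lemma segment_affine:
  assumes seg: "\<And>t. t \<in> {0..1} \<Longrightarrow> x + t *\<^sub>R h \<in> U"
  shows "f (x + h) = f x + D x h"
proof -
  have "q i (f (x + h) - f x - D x h) = 0" for i
  proof -
    define g where "g t = f (x + t *\<^sub>R h) - f x - t *\<^sub>R D x h" for t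
    have "((\<lambda>t. q i (g t)) has_real_derivative 0) (at t)" if t: "t \<in> {0..1}" for t
      unfolding has_field_derivative_iff LIM_eq
    proof (intro allI impI)
      fix e :: real assume e: "e > 0"
      have "1 / 2 ^ i * (e / (1 + e)) > 0" using e by simp
      then have "\<forall>\<^sub>F s in at 0. fnorm q ((1 / s) *\<^sub>R (f (x + t *\<^sub>R h + s *\<^sub>R h) - f (x + t *\<^sub>R h))
          - D (x + t *\<^sub>R h) h) < 1 / 2 ^ i * (e / (1 + e))"
        using MC_on_has_dir_deriv[OF seg[OF t]] unfolding has_dir_deriv_iff by blast
      then obtain d where d: "d > 0" "\<And>s. \<lbrakk>s \<noteq> 0; \<bar>s\<bar> < d\<rbrakk> \<Longrightarrow>
          q i ((1 / s) *\<^sub>R (f (x + t *\<^sub>R h + s *\<^sub>R h) - f (x + t *\<^sub>R h)) - D (x + t *\<^sub>R h) h) < e"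
        unfolding eventually_at using F.fnorm_less_imp_seminorm_less[OF e] by (auto simp: dist_real_def)
      have "\<bar>(q i (g u) - q i (g t)) / (u - t)\<bar> < e" if u: "u \<noteq> t" "\<bar>u - t\<bar> < d" for u
      proof -
        let ?s = "u - t"
        \<comment> \<open>\<open>?Q\<close> is the error of the difference quotient at parameter
          \<open>t\<close>, small for small \<open>?s\<close>; \<open>?R\<close> is the change of
          the derivative from \<open>x\<close>, which \<open>q i\<close> annihilates.\<close>
        let ?Q = "(1 / ?s) *\<^sub>R (f (x + t *\<^sub>R h + ?s *\<^sub>R h) - f (x + t *\<^sub>R h)) - D (x + t *\<^sub>R h) h"
        let ?R = "D (x + t *\<^sub>R h) h - D x h"
        have "x + t *\<^sub>R h + ?s *\<^sub>R h = x + u *\<^sub>R h" by (simp add: algebra_simps)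
        then have "g u - g t = ?s *\<^sub>R (?Q + ?R)"
          using u(1) by (simp add: g_def scaleR_diff_right) (simp add: algebra_simps)
        then have "q i (g u - g t) = \<bar>?s\<bar> * q i (?Q + ?R)"
          by (simp only: F.seminorm_scaleR)
        also have "\<dots> \<le> \<bar>?s\<bar> * (q i ?Q + q i ?R)"
          by (intro mult_left_mono F.seminorm_add) simp
        also have "\<dots> < \<bar>?s\<bar> * e"
          using d(2)[of ?s] u segment_deriv_const[OF seg t] by simp
        finally have "q i (g u - g t) < \<bar>?s\<bar> * e" .
        \<comment> \<open>With the next inequality this is the reverse triangle inequality, passing
          from \<open>g\<close> to \<open>q i\<close> of \<open>g\<close>.\<close>
        moreover have "q i (g u) \<le> q i (g t) + q i (g u - g t)"
          using F.seminorm_add[of i "g t" "g u - g t"] by simp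
        moreover have "q i (g t) \<le> q i (g u) + q i (g u - g t)"
          using F.seminorm_diff[of i "g u" "g u - g t"] by simp
        ultimately have "\<bar>q i (g u) - q i (g t)\<bar> < \<bar>?s\<bar> * e" by linarith
        then show ?thesis using u(1) by (simp add: abs_divide field_simps)
      qed
      with d(1) show "\<exists>d>0. \<forall>u. u \<noteq> t \<and> norm (u - t) < d \<longrightarrow>
          norm ((q i (g u) - q i (g t)) / (u - t) - 0) < e"
        by (intro exI[of _ d]) auto
    qed
    then obtain c where "\<And>t. t \<in> {0..1} \<Longrightarrow> q i (g t) = c"
      using has_field_derivative_zero_constant[of "{0..1}" "\<lambda>t. q i (g t)"]
      by (metis has_field_derivative_at_within convex_real_interval(5))
    from this[of 0] this[of 1] show ?thesis
      by (simp add: g_def F.seminorm_zero)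
  qed
  then have "f (x + h) - f x - D x h = 0" by (rule F.separating)
  then show ?thesis by (simp add: algebra_simps)
qed

text \<open>The radius comes from openness of \<open>U\<close> alone: with \<open>h\<close> small
  all of \<open>t *\<^sub>R h\<close>, \<open>t\<close> in [0,1], are small, so the segment stays in
  \<open>U\<close>.\<close>

lemma MC_on_locally_affine:
  assumes "x \<in> U"
  obtains r where "r > 0" "\<And>h. fnorm p h < r \<Longrightarrow> x + h \<in> U"
    "\<And>h. fnorm p h < r \<Longrightarrow> f (x + h) = f x + D x h"
proof -
  obtain r where r: "r > 0" "E.mball x r \<subseteq> U"
    using MC_on_openin assms unfolding E.openin_mtopology by blast
  have U: "x + h \<in> U" if "fnorm p h < r" for h
    using r(2) that E.norm_minus[of h] by auto
  have "x + t *\<^sub>R h \<in> U" if "fnorm p h < r" "t \<in> {0..1}" for t h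
    using that E.fnorm_scaleR_mono[of t 1 h] by (intro U) auto
  then show thesis using that[OF r(1)] U segment_affine by blast
qed

end

end

section \<open>The open mapping theorem\<close>

context frechet_pair
begin

context
  fixes L :: "'e \<Rightarrow> 'f" and C :: real
  assumes linear: "linear L" and bound: "\<And>x. fnorm q (L x) \<le> C * fnorm p x" and surj: "surj L"
begin

text \<open>Dilates of the image of a ball cover the target, so by Baire the closure of one dilate
  contains a ball. Subtracting approximations of two of its points recentres it at 0; this costs a
  factor 2, hence \<open>r / 2\<close> in \<open>T\<close>.\<close>

lemma almost_open:
  assumes "r > 0"
  obtains s where "s > 0"
    "\<And>y e. \<lbrakk>fnorm q y < s; e > 0\<rbrakk> \<Longrightarrow> \<exists>x. fnorm p x < r \<and> fnorm q (y - L x) < e"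
proof -
  define T where "T k = (\<lambda>x. real (Suc k) *\<^sub>R L x) ` {x. fnorm p x < r / 2}" for k
  have "\<exists>k. F.mtopology interior_of (F.mtopology closure_of T k) \<noteq> {}"
  proof (rule ccontr)
    assume "\<not> ?thesis"
    then have "F.mtopology interior_of \<Union> (range (\<lambda>k. F.mtopology closure_of T k)) = {}"
      using F.complete by (intro F.metric_Baire_category_alt) auto
    moreover have "\<Union> (range (\<lambda>k. F.mtopology closure_of T k)) = UNIV"
    proof (intro equalityI subset_UNIV subsetI)
      fix y
      obtain x where x: "y = L x" using surj by (rule surjE)
      obtain d where d: "d > 0" "\<And>t. \<bar>t\<bar> < d \<Longrightarrow> fnorm p (t *\<^sub>R x) < r / 2"
        using E.fnorm_scaleR_small[of "r / 2"] assms by auto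
      obtain k where k: "inverse (real (Suc k)) < d" using reals_Archimedean d(1) by blast
      have "y = real (Suc k) *\<^sub>R L (inverse (real (Suc k)) *\<^sub>R x)"
        by (simp only: linear_scale[OF linear]) (simp add: x)
      moreover have "fnorm p (inverse (real (Suc k)) *\<^sub>R x) < r / 2"
        using k by (intro d(2)) simp
      ultimately have "y \<in> T k" unfolding T_def by blast
      then have "y \<in> F.mtopology closure_of T k"
        using closure_of_subset[of "T k" F.mtopology] by auto
      then show "y \<in> \<Union> (range (\<lambda>k. F.mtopology closure_of T k))" by blast
    qed
    ultimately show False
      using interior_of_topspace[of F.mtopology] by simp
  qed
  then obtain k y0 where "y0 \<in> F.mtopology interior_of (F.mtopology closure_of T k)" by blast
  then obtain d where d: "d > 0" "F.mball y0 d \<subseteq> F.mtopology closure_of T k"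
    unfolding F.in_interior_of_mball by blast
  have approx: "\<exists>x. fnorm p x < r / 2 \<and> fnorm q (z - real (Suc k) *\<^sub>R L x) < e"
    if "fnorm q (y0 - z) < d" "e > 0" for z e
  proof -
    have "z \<in> F.mtopology closure_of T k" using d(2) that(1) by auto
    then show ?thesis using that(2) unfolding F.metric_closure_of T_def by auto
  qed
  show thesis
  proof (rule that)
    show "d / real (Suc k) > 0" using d(1) by simp
    fix y e assume y: "fnorm q y < d / real (Suc k)" and e: "(e::real) > 0"
    \<comment> \<open>Subadditivity replaces homogeneity for integer multiples; this is why the
      radius \<open>d / real (Suc k)\<close> suffices.\<close>
    have mult: "fnorm q (real n *\<^sub>R y) \<le> real n * fnorm q y" for n
    proof (induction n)
      case (Suc n)
      have "fnorm q (real (Suc n) *\<^sub>R y) \<le> fnorm q (real n *\<^sub>R y) + fnorm q y"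
        using F.fnorm_add[of "real n *\<^sub>R y" y] by (simp add: scaleR_left_distrib add.commute)
      with Suc show ?case by (simp add: algebra_simps)
    qed (simp add: F.fnorm_zero)
    have "fnorm q (real (Suc k) *\<^sub>R y) < d"
      using mult[of "Suc k"] y by (simp add: field_simps)
    then have "fnorm q (y0 - (y0 + real (Suc k) *\<^sub>R y)) < d"
      using F.norm_minus[of "real (Suc k) *\<^sub>R y"] by simp
    then obtain x1 where x1: "fnorm p x1 < r / 2"
      "fnorm q (y0 + real (Suc k) *\<^sub>R y - real (Suc k) *\<^sub>R L x1) < e / 2"
      using approx[of "y0 + real (Suc k) *\<^sub>R y" "e / 2"] e by auto
    obtain x2 where x2: "fnorm p x2 < r / 2" "fnorm q (y0 - real (Suc k) *\<^sub>R L x2) < e / 2"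
      using approx[of y0 "e / 2"] e d(1) by (auto simp: F.norm_zero)
    have "real (Suc k) *\<^sub>R (y - L (x1 - x2)) =
        (y0 + real (Suc k) *\<^sub>R y - real (Suc k) *\<^sub>R L x1) - (y0 - real (Suc k) *\<^sub>R L x2)"
      by (simp add: linear_diff[OF linear] algebra_simps)
    then have "fnorm q (real (Suc k) *\<^sub>R (y - L (x1 - x2))) < e"
      using F.norm_diff[of "y0 + real (Suc k) *\<^sub>R y - real (Suc k) *\<^sub>R L x1"
          "y0 - real (Suc k) *\<^sub>R L x2"] x1(2) x2(2) by simp
    \<comment> \<open>Undoing the dilation by a factor at least 1 does not increase
      \<open>fnorm\<close>.\<close>
    then have "fnorm q (y - L (x1 - x2)) < e"
      using F.fnorm_scaleR_mono[of 1 "real (Suc k)" "y - L (x1 - x2)"] by simp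
    moreover have "fnorm p (x1 - x2) < r"
      using E.norm_diff[of x1 x2] x1(1) x2(1) by simp
    ultimately show "\<exists>x. fnorm p x < r \<and> fnorm q (y - L x) < e" by blast
  qed
qed

text \<open>Each remainder is approximated by the image of a far smaller vector, and the corrections
  are summed. Their bounds \<open>r / 2 ^ (n + 2)\<close> add up to \<open>r / 2\<close>, so the
  limit stays strictly inside the ball of radius \<open>r\<close>.\<close>

lemma open_mapping:
  assumes "r > 0"
  obtains s where "s > 0" "\<And>y. fnorm q y < s \<Longrightarrow> \<exists>x. fnorm p x < r \<and> L x = y"
proof -
  have "\<exists>s. 0 < s \<and> (\<forall>y e. fnorm q y < s \<longrightarrow> e > 0 \<longrightarrow>
      (\<exists>x. fnorm p x < r / 2 ^ (n + 2) \<and> fnorm q (y - L x) < e))" for n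
    by (rule almost_open[of "r / 2 ^ (n + 2)"]) (use assms in auto)
  then obtain s0 where s0: "\<And>n. 0 < s0 n" "\<And>n y e. \<lbrakk>fnorm q y < s0 n; e > 0\<rbrakk> \<Longrightarrow>
      \<exists>x. fnorm p x < r / 2 ^ (n + 2) \<and> fnorm q (y - L x) < e"
    by metis
  \<comment> \<open>The bound \<open>1 / 2 ^ n\<close> makes the remainders tend to 0;
    \<open>s0 n\<close> makes the next correction possible.\<close>
  define s where "s n = min (s0 n) (1 / 2 ^ n)" for n
  have s: "0 < s n" "s n \<le> 1 / 2 ^ n" for n using s0(1) by (auto simp: s_def)
  define X where "X n y = (SOME x. fnorm p x < r / 2 ^ (n + 2) \<and> fnorm q (y - L x) < s (Suc n))" for n y
  have X: "fnorm p (X n y) < r / 2 ^ (n + 2)" "fnorm q (y - L (X n y)) < s (Suc n)"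
    if "fnorm q y < s n" for n y
  proof -
    have "\<exists>x. fnorm p x < r / 2 ^ (n + 2) \<and> fnorm q (y - L x) < s (Suc n)"
      using that s(1) by (intro s0(2)) (auto simp: s_def)
    from someI_ex[OF this] show "fnorm p (X n y) < r / 2 ^ (n + 2)" "fnorm q (y - L (X n y)) < s (Suc n)"
      by (auto simp: X_def)
  qed
  show thesis
  proof (rule that[OF s(1)[of 0]])
    fix y assume y: "fnorm q y < s 0"
    \<comment> \<open>\<open>Z n\<close> is the part of \<open>y\<close> still missing after
      \<open>n\<close> corrections.\<close>
    define Z where "Z = rec_nat y (\<lambda>n z. z - L (X n z))"
    have Z_simps: "Z 0 = y" "Z (Suc n) = Z n - L (X n (Z n))" for n by (simp_all add: Z_def)
    have Z: "fnorm q (Z n) < s n" for n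
      by (induction n) (use y X(2) in \<open>simp_all add: Z_simps\<close>)
    define S where "S n = (\<Sum>i<n. X i (Z i))" for n
    have LS: "L (S n) = y - Z n" for n
      by (induction n) (simp_all add: S_def Z_simps linear_0[OF linear] linear_add[OF linear])
    \<comment> \<open>The right-hand side is the exact geometric sum of the bounds on the
      corrections from \<open>n\<close> to \<open>n + m - 1\<close>.\<close>
    have tail: "fnorm p (S (n + m) - S n) \<le> r / 2 ^ (n + 1) - r / 2 ^ (n + m + 1)" for n m
    proof (induction m)
      case (Suc m)
      have "S (n + Suc m) - S n = (S (n + m) - S n) + X (n + m) (Z (n + m))"
        by (simp add: S_def)
      then have "fnorm p (S (n + Suc m) - S n) \<le> fnorm p (S (n + m) - S n) + r / 2 ^ (n + m + 2)"
        using E.fnorm_add[of "S (n + m) - S n"] X(1)[OF Z, of "n + m"] by (smt (verit))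
      moreover have "r / 2 ^ (n + m + 1) = 2 * (r / 2 ^ (n + m + 2))" by simp
      moreover have "r / 2 ^ (n + Suc m + 1) = r / 2 ^ (n + m + 2)" by simp
      ultimately show ?case using Suc by linarith
    qed (simp add: E.fnorm_zero)
    have dist: "fnorm p (S m - S n) \<le> r / 2 ^ (n + 1)" if "n \<le> m" for n m
      using tail[of n "m - n"] that assms by (smt (verit) le_add_diff_inverse zero_le_divide_iff zero_le_power)
    have "E.MCauchy S"
      unfolding E.MCauchy_def
    proof (intro conjI allI impI)
      fix e :: real assume e: "e > 0"
      obtain K where K: "(1 / 2) ^ K < e / r"
        using real_arch_pow_inv[of "e / r" "1 / 2"] e assms by auto
      have small: "r / 2 ^ (n + 1) < e" if "K \<le> n" for n
      proof -
        have "(1 / 2) ^ (n + 1) \<le> (1 / 2 :: real) ^ K" using that by (intro power_decreasing) auto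
        with K have "(1 / 2) ^ (n + 1) < e / r" by linarith
        with assms show ?thesis by (simp add: field_simps)
      qed
      have lt: "fnorm p (S m - S n) < e" if "K \<le> n" "n \<le> m" for n m
        using dist[OF that(2)] small[OF that(1)] by linarith
      have "fnorm p (S n - S m) < e" if "K \<le> n" "K \<le> m" for n m
      proof (cases "n \<le> m")
        case True
        then show ?thesis using lt[OF that(1) True] by (subst E.norm_diff_commute)
      next
        case False
        then show ?thesis using that(2) by (intro lt) auto
      qed
      then show "\<exists>K. \<forall>n m. K \<le> n \<longrightarrow> K \<le> m \<longrightarrow> fnorm p (S n - S m) < e"
        by blast
    qed simp
    then obtain x where "limitin E.mtopology S x sequentially"
      using E.complete unfolding E.mcomplete_def by blast
    then have lim: "\<exists>N. \<forall>n\<ge>N. fnorm p (S n - x) < e" if "e > 0" for e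
      using that unfolding E.limit_metric_sequentially by blast
    \<comment> \<open>\<open>C\<close> may be zero or negative, and a positive constant is required
      as a divisor.\<close>
    have C: "0 < max C 1" "fnorm q (L v) \<le> max C 1 * fnorm p v" for v
      using bound[of v] mult_right_mono[of C "max C 1" "fnorm p v"] E.norm_nonneg[of v] by auto
    have "fnorm q (y - L x) \<le> 0"
    proof (rule field_le_epsilon)
      fix e :: real assume e: "e > 0"
      then obtain N where N: "\<And>n. n \<ge> N \<Longrightarrow> fnorm p (S n - x) < e / 2 / max C 1"
        using lim[of "e / 2 / max C 1"] C(1) by auto
      obtain K where K: "(1 / 2) ^ K < e / 2"
        using real_arch_pow_inv[of "e / 2" "1 / 2"] e by auto
      define n where "n = max N K"
      have "y - L x = Z n + L (S n - x)"
        by (simp add: linear_diff[OF linear] LS)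
      then have "fnorm q (y - L x) \<le> fnorm q (Z n) + fnorm q (L (S n - x))"
        using F.fnorm_add by metis
      moreover have "fnorm q (Z n) < e / 2"
      proof -
        have "fnorm q (Z n) < (1 / 2) ^ n" using Z[of n] s(2)[of n] by (simp add: power_one_over)
        also have "\<dots> \<le> (1 / 2) ^ K" by (intro power_decreasing) (auto simp: n_def)
        finally show ?thesis using K by linarith
      qed
      moreover have "fnorm q (L (S n - x)) < e / 2"
      proof -
        have "fnorm q (L (S n - x)) \<le> max C 1 * fnorm p (S n - x)" by (rule C(2))
        also have "\<dots> < max C 1 * (e / 2 / max C 1)"
          using N[of n] C(1) by (intro mult_strict_left_mono) (auto simp: n_def)
        also have "\<dots> = e / 2" using C(1) by simp
        finally show ?thesis .
      qed
      ultimately show "fnorm q (y - L x) \<le> 0 + e" by linarith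
    qed
    then have "L x = y" using F.norm_nonneg[of "y - L x"] F.norm_eq_0[of "y - L x"] by simp
    moreover have "fnorm p x < r"
    proof -
      obtain n where n: "fnorm p (S n - x) < r / 2" using lim[of "r / 2"] assms by auto
      have "fnorm p (S n) \<le> r / 2"
        using dist[of 0 n] by (simp add: S_def)
      with n show ?thesis using E.norm_diff[of "S n" "S n - x"] by simp
    qed
    ultimately show "\<exists>x. fnorm p x < r \<and> L x = y" by blast
  qed
qed

end

end

section \<open>Codimension\<close>

text \<open>The projection \<open>P\<close> onto \<open>D\<close> along \<open>S\<close> has kernel
  \<open>S\<close>, so it maps the other complement \<open>C\<close> bijectively onto
  \<open>D\<close> and carries a basis of \<open>C\<close> to a basis of \<open>D\<close>.\<close>

lemma complementary_dim_eq:
  assumes "complementary S C" "complementary S D"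
  shows "dim C = dim D"
proof -
  have S: "subspace S" and C: "subspace C" "S \<inter> C = {0}" and D: "subspace D" "S \<inter> D = {0}"
    using assms by (simp_all add: complementary_def)
  have decomp: "\<exists>s d. s \<in> S \<and> d \<in> D \<and> x = s + d" "\<exists>s c. s \<in> S \<and> c \<in> C \<and> x = s + c" for x
  proof -
    have "x \<in> {s + d | s d. s \<in> S \<and> d \<in> D}" "x \<in> {s + c | s c. s \<in> S \<and> c \<in> C}"
      using assms by (simp_all only: complementary_def UNIV_I)
    then show "\<exists>s d. s \<in> S \<and> d \<in> D \<and> x = s + d" "\<exists>s c. s \<in> S \<and> c \<in> C \<and> x = s + c"
      by blast+
  qed
  have "\<exists>d. d \<in> D \<and> x - d \<in> S" for x
  proof -
    obtain s d where "s \<in> S" "d \<in> D" "x = s + d" using decomp(1) by blast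
    then show ?thesis by (intro exI[of _ d]) simp
  qed
  then obtain P where "\<And>x. P x \<in> D \<and> x - P x \<in> S" by metis
  then have P: "P x \<in> D" "x - P x \<in> S" for x by simp_all
  have P_eq: "P x = d" if "d \<in> D" "x - d \<in> S" for x d
  proof -
    have "P x - d \<in> D" by (rule subspace_diff[OF D(1) P(1) that(1)])
    moreover have "P x - d \<in> S"
      using subspace_diff[OF S that(2) P(2)[of x]] by simp
    ultimately have "P x - d \<in> {0}" unfolding D(2)[symmetric] by (rule IntI[rotated])
    then show ?thesis by simp
  qed
  have "linear P"
  proof (rule linearI)
    show "P (x + y) = P x + P y" for x y
      using subspace_add[OF S P(2)[of x] P(2)[of y]] subspace_add[OF D(1) P(1) P(1)]
      by (intro P_eq) (auto simp: algebra_simps)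
    show "P (c *\<^sub>R x) = c *\<^sub>R P x" for c x
      using subspace_scale[OF S P(2)[of x], of c] subspace_scale[OF D(1) P(1)]
      by (intro P_eq) (auto simp: algebra_simps)
  qed
  moreover have "inj_on P (span C)"
  proof (rule inj_onI)
    fix x y assume "x \<in> span C" "y \<in> span C" and eq: "P x = P y"
    then have "x \<in> C" "y \<in> C" using C(1) by (simp_all add: span_eq_iff[THEN iffD2])
    then have "x - y \<in> C" by (rule subspace_diff[OF C(1)])
    moreover have "x - y \<in> S"
      using subspace_diff[OF S P(2)[of x] P(2)[of y]] eq by simp
    ultimately have "x - y \<in> {0}" unfolding C(2)[symmetric] by (rule IntI[rotated])
    then show "x = y" by simp
  qed
  moreover have "P ` C = D"
  proof (intro equalityI subsetI)
    fix d assume d: "d \<in> D"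
    obtain s c where sc: "s \<in> S" "c \<in> C" "d = s + c" using decomp(2) by blast
    have "P c = d"
      using d sc subspace_neg[OF S sc(1)] by (intro P_eq) auto
    then show "d \<in> P ` C" using sc(2) by blast
  qed (use P(1) in auto)
  ultimately have P_lin: "linear P" "inj_on P (span C)" "P ` C = D" .
  obtain A where A: "A \<subseteq> C" "independent A" "C \<subseteq> span A" "card A = dim C"
    using basis_exists by blast
  have span: "span A = C" using A(1,3) C(1) span_minimal by blast
  have inj: "inj_on P (span A)" using P_lin(2) C(1) span by (simp add: span_eq_iff[THEN iffD2])
  have "independent (P ` A)"
    using A(2) linear_dependent_inj_imageD[OF P_lin(1) _ inj] by blast
  moreover have "span (P ` A) = span D"
    using linear_span_image[OF P_lin(1), of A] span P_lin(3) D(1) by (simp add: span_eq_iff[THEN iffD2])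
  ultimately have "dim D = card (P ` A)" by (rule dim_eq_card[rotated])
  also have "\<dots> = card A" using inj_on_subset[OF inj span_superset] by (rule card_image)
  finally show ?thesis using A(4) by simp
qed

lemma codim_eq_dim: "complementary S C \<Longrightarrow> codim S = dim C"
  unfolding codim_def using complementary_dim_eq by (intro the_equality) blast+

text \<open>\<open>dim\<close> is the cardinality of a basis, which is also 0 for an infinite basis;
  finite dimension rules that case out.\<close>

lemma finite_dim_dim_0:
  assumes "finite_dim C" "dim C = 0"
  shows "C \<subseteq> {0}"
proof -
  obtain B where B: "finite B" "span B = C" using assms(1) by (auto simp: finite_dim_def)
  obtain A where A: "A \<subseteq> B" "independent A" "B \<subseteq> span A"
    using maximal_independent_subset[of B] by blast
  have span: "span A = span B"
    using A(1,3) by (simp add: span_mono span_minimal subset_antisym)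
  have "card A = 0"
    using dim_eq_card[OF span] A(2) assms(2) B(2) dim_span[of B] by simp
  then have "A = {}" using finite_subset[OF A(1) B(1)] by simp
  then show ?thesis using span B(2) by auto
qed

lemma codim_0_imp_UNIV:
  assumes "finite_codim S" "codim S = 0"
  shows "S = UNIV"
proof -
  obtain C where C: "complementary S C" "finite_dim C" using assms(1) by (auto simp: finite_codim_def)
  then have "C \<subseteq> {0}" using codim_eq_dim assms(2) finite_dim_dim_0 by metis
  moreover have "\<exists>s c. s \<in> S \<and> c \<in> C \<and> x = s + c" for x
  proof -
    have "x \<in> {s + c | s c. s \<in> S \<and> c \<in> C}"
      using C(1) by (simp only: complementary_def UNIV_I)
    then show ?thesis by blast
  qed
  ultimately show ?thesis by fastforce
qed

section \<open>Charts\<close>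

lemma is_chart_inj_on: "is_chart p M (U, \<psi>) \<Longrightarrow> inj_on \<psi> U"
  using openin_subset[of M U] homeomorphic_imp_injective_map[of "subtopology M U" _ \<psi>]
  by (fastforce simp: is_chart_def Int_absorb1)

lemma is_chart_openin_image:
  assumes "is_chart p M (U, \<psi>)" "openin M G" "G \<subseteq> U"
  shows "openin (frechet_top p) (\<psi> ` G)"
proof -
  have "openin (subtopology M U) G"
    using assms(2,3) openin_subtopology_Int2[of M G U] by (simp add: Int_absorb1)
  then have "openin (subtopology (frechet_top p) (\<psi> ` U)) (\<psi> ` G)"
    using assms(1) homeomorphic_imp_open_map unfolding is_chart_def open_map_def by blast
  then show ?thesis
    using assms(1) by (simp add: is_chart_def openin_open_subtopology)
qed

lemma is_chart_openin_preimage: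
  assumes "is_chart p M (U, \<psi>)" "openin (frechet_top p) G"
  shows "openin M {x \<in> U. \<psi> x \<in> G}"
proof -
  have U: "openin M U" using assms(1) by (simp add: is_chart_def)
  have "continuous_map (subtopology M U) (frechet_top p) \<psi>"
    using assms(1) homeomorphic_imp_continuous_map continuous_map_into_fulltopology
    unfolding is_chart_def by blast
  then have "openin (subtopology M U) {x \<in> topspace (subtopology M U). \<psi> x \<in> G}"
    using assms(2) by (rule openin_continuous_map_preimage)
  then show ?thesis
    using U openin_subset[OF U] by (simp add: openin_open_subtopology Int_absorb1)
qed

theorem theorem3p7:
  fixes p :: "nat \<Rightarrow> 'e::real_vector \<Rightarrow> real" and q :: "nat \<Rightarrow> 'f::real_vector \<Rightarrow> real"
    and M :: "'m topology" and N :: "'n topology"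
    and A :: "('m, 'e) chart set" and B :: "('n, 'f) chart set"
    and \<phi> :: "'m \<Rightarrow> 'n" and k :: nat
  assumes "k > 1"
    and "MC_manifold k p M A" and "connected_space M"
    and "MC_manifold k q N B" and "connected_space N"
    and "MC_lipschitz_fredholm_map k p M A q N B \<phi>"
    and "has_index A q B \<phi> 0"
    and "locally_injective M \<phi>"
  shows "open_map M N \<phi>"
  unfolding open_map_def
proof (intro allI impI)
  have "frechet p" "frechet q"
    using assms(2,4) by (simp_all add: MC_manifold_def frechet_space_iff)
  then interpret frechet_pair p q by (simp add: frechet_pair_def)
  interpret two_norms "fnorm p" UNIV "fnorm q" ..
  have charts: "is_chart p M c" "is_chart q N d" if "c \<in> A" "d \<in> B" for c d
    using assms(2,4) that by (auto simp: MC_manifold_def)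
  have cont: "continuous_map M N \<phi>"
    and MC: "\<And>c d. \<lbrakk>c \<in> A; d \<in> B\<rbrakk> \<Longrightarrow>
        MC_on k p q (snd c ` {x \<in> fst c. \<phi> x \<in> fst d}) (local_rep c d \<phi>)"
    using assms(6) by (auto simp: MC_lipschitz_fredholm_map_def MC_map_def)
  fix O' assume O: "openin M O'"
  show "openin N (\<phi> ` O')"
    unfolding openin_subopen[of N "\<phi> ` O'"]
  proof (intro ballI)
    fix y0 assume "y0 \<in> \<phi> ` O'"
    then obtain x0 where x0: "x0 \<in> O'" "y0 = \<phi> x0" by blast
    have x0M: "x0 \<in> topspace M" using O x0(1) openin_subset by blast
    then have y0N: "\<phi> x0 \<in> topspace N" using cont by (auto simp: continuous_map_def)
    obtain U \<psi> where c: "(U, \<psi>) \<in> A" "x0 \<in> U"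
      using assms(2) x0M unfolding MC_manifold_def by blast
    obtain V \<eta> where d: "(V, \<eta>) \<in> B" "\<phi> x0 \<in> V"
      using assms(4) y0N unfolding MC_manifold_def by blast
    have chart: "is_chart p M (U, \<psi>)" "is_chart q N (V, \<eta>)"
      using charts c(1) d(1) by blast+
    have inj: "inj_on \<psi> U" "inj_on \<eta> V" using chart is_chart_inj_on by blast+
    obtain W where W: "openin M W" "x0 \<in> W" "inj_on \<phi> W"
      using assms(8) x0M unfolding locally_injective_def by blast
    define f where "f = local_rep (U, \<psi>) (V, \<eta>) \<phi>"
    have f: "f (\<psi> x) = \<eta> (\<phi> x)" if "x \<in> U" for x
      using that inj(1) by (simp add: f_def local_rep_def)
    define a where "a = \<psi> x0"
    define L where "L = dir_deriv UNIV (frechet_dist q) f a"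
    \<comment> \<open>A neighbourhood of \<open>x0\<close> on which both charts apply and
      \<open>\<phi>\<close> is injective; points found in it lie in \<open>O'\<close>.\<close>
    define G where "G = O' \<inter> W \<inter> U \<inter> {x \<in> topspace M. \<phi> x \<in> V}"
    have U: "openin M U" and V: "openin N V" using chart by (auto simp: is_chart_def)
    have "openin M G"
      unfolding G_def using O W(1) U openin_continuous_map_preimage[OF cont V] by blast
    then have "openin E.mtopology (\<psi> ` G)"
      using is_chart_openin_image[OF chart(1)] by (simp add: G_def frechet_dist_eq_fnorm le_infI1)
    moreover have "a \<in> \<psi> ` G" using x0(1) x0M c(2) d(2) W(2) by (auto simp: a_def G_def)
    ultimately obtain r1 where r1: "r1 > 0" "E.mball a r1 \<subseteq> \<psi> ` G"
      unfolding E.openin_mtopology by blast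
    have MCf: "MC_on k p q (\<psi> ` {x \<in> U. \<phi> x \<in> V}) f" using MC[OF c(1) d(1)] by (simp add: f_def)
    have aU: "a \<in> \<psi> ` {x \<in> U. \<phi> x \<in> V}" using c(2) d(2) by (simp add: a_def)
    obtain r2 where r2: "r2 > 0" "\<And>h. fnorm p h < r2 \<Longrightarrow> f (a + h) = f a + L h"
    proof (rule MC_on_locally_affine[OF less_imp_le[OF assms(1)] MCf aU])
      fix r assume "r > 0" "\<And>h. fnorm p h < r \<Longrightarrow>
        f (a + h) = f a + dir_deriv UNIV (frechet_dist q) f a h"
      then show thesis by (intro that[of r]) (simp_all add: L_def)
    qed
    define r where "r = min r1 r2"
    have r: "r > 0" using r1(1) r2(1) by (simp add: r_def)
    \<comment> \<open>Every small displacement \<open>h\<close> comes from a point of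
      \<open>G\<close> at which the chart expression is affine. This serves twice: for injectivity
      of \<open>L\<close> and for lifting points of the target.\<close>
    have lift: "\<exists>x\<in>G. a + h = \<psi> x \<and> \<eta> (\<phi> x) = f a + L h" if "fnorm p h < r" for h
    proof -
      have "a + h \<in> E.mball a r1" using that E.norm_minus[of h] by (simp add: r_def)
      then obtain x where x: "x \<in> G" "a + h = \<psi> x" using r1(2) by blast
      then have "\<eta> (\<phi> x) = f (a + h)" using f by (simp add: G_def)
      then show ?thesis using x r2(2)[of h] that by (auto simp: r_def)
    qed
    have fa: "f a = \<eta> (\<phi> x0)" using f[OF c(2)] by (simp add: a_def)
    have L_eq: "L = chart_deriv q (U, \<psi>) (V, \<eta>) \<phi> x0"
      by (simp add: L_def chart_deriv_def f_def a_def)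
    have fredholm: "lipschitz_fredholm p q L"
      using assms(6) c d unfolding MC_lipschitz_fredholm_map_def L_eq by fastforce
    have index: "fredholm_index L = 0"
      using assms(7) c d unfolding has_index_def L_eq by fastforce
    have maps: "L \<in> maps"
      using fredholm by (simp add: lipschitz_fredholm_def frechet_dist_eq_fnorm)
    then have linear: "linear L" by (simp add: lip_maps_def)
    have "kernel L = {0}"
    proof (intro equalityI subsetI)
      fix h assume "h \<in> kernel L"
      then have Lh: "L h = 0" by (simp add: kernel_def)
      \<comment> \<open>A kernel vector may be scaled into the ball without leaving the kernel. The
        lifted point then has the same image as \<open>x0\<close>, so local injectivity identifies
        the two.\<close>
      obtain t where t: "t > 0" "fnorm p (t *\<^sub>R h) < r"
        using E.fnorm_scaleR_small[OF r, of h] by (metis abs_of_pos dense)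
      obtain x where x: "x \<in> G" "a + t *\<^sub>R h = \<psi> x" "\<eta> (\<phi> x) = \<eta> (\<phi> x0)"
        using lift[OF t(2)] by (auto simp: linear_scale[OF linear] Lh fa)
      then have "\<phi> x = \<phi> x0" using inj(2) d(2) by (auto simp: G_def dest: inj_onD)
      then have "x = x0" using W(2,3) x(1) by (auto simp: G_def dest: inj_onD)
      then show "h \<in> {0}" using x(2) t(1) by (simp add: a_def)
    qed (simp add: kernel_def linear_0[OF linear])
    then have "dim (kernel L) = 0"
      using dim_span_eq_card_independent[OF real_vector.independent_empty] by simp
    then have "codim (range L) = 0" using index by (simp add: fredholm_index_def)
    then have surj: "surj L"
      using fredholm codim_0_imp_UNIV by (auto simp: lipschitz_fredholm_def)
    obtain s where s: "s > 0" "\<And>y. fnorm q y < s \<Longrightarrow> \<exists>h. fnorm p h < r \<and> L h = y"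
      using open_mapping[OF linear maps_bound[OF maps] surj r] by blast
    \<comment> \<open>\<open>L\<close> reaches every vector of norm below \<open>s\<close> from the
      ball of radius \<open>r\<close>, so each point of \<open>T\<close> has a preimage in
      \<open>G\<close>.\<close>
    define T where "T = {y \<in> V. \<eta> y \<in> F.mball (f a) s}"
    have "openin N T"
      unfolding T_def using chart(2) F.openin_mball
      by (intro is_chart_openin_preimage) (auto simp: frechet_dist_eq_fnorm)
    moreover have "y0 \<in> T" using d(2) s(1) by (simp add: T_def x0(2) fa F.norm_zero)
    moreover have "T \<subseteq> \<phi> ` O'"
    proof
      fix y assume y: "y \<in> T"
      then have "fnorm q (\<eta> y - f a) < s"
        using F.norm_diff_commute by (simp add: T_def)
      then obtain h where h: "fnorm p h < r" "L h = \<eta> y - f a" using s(2) by blast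
      obtain x where x: "x \<in> G" "\<eta> (\<phi> x) = \<eta> y"
        using lift[OF h(1)] h(2) by auto
      then have "\<phi> x = y" using inj(2) y by (auto simp: G_def T_def dest: inj_onD)
      then show "y \<in> \<phi> ` O'" using x(1) by (auto simp: G_def)
    qed
    ultimately show "\<exists>T. openin N T \<and> y0 \<in> T \<and> T \<subseteq> \<phi> ` O'" by blast
  qed
qed

end
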